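(* Let $\mathcal V$ be a commutative quantale and let $T:\mathsf{Set}\to\mathsf{Set}$ be a weak pullback preserving functor. Then the $\mathcal V\text{-}\mathsf{cat}$-ification $T_{\mathcal V}=\mathrm{Lan}_D(DT)$ of $T$ is given, for every small $\mathcal V$-category $\mathcal X$ with object set $X_{\mathsf o}$ and all $A',A\in TX_{\mathsf o}$, by $$T_{\mathcal V}\mathcal X(A',A)=\bigvee\{s\in\mathcal V_o\mid(A',A)\in\mathsf{Rel}_T(X_s)\}.$$
   Context: $\mathcal V=(\mathcal V_o,\otimes,e,[-,-])$ is a commutative quantale: a complete lattice with a commutative, associative, monotone operation $\otimes$ with unit $e$, such that each $-\otimes r$ has a right adjoint $[r,-]$; $\mathcal V$ is assumed non-trivial ($e\neq\bot$). A (small) $\mathcal V$-category $\mathcal X$ is a set of objects together with elements $\mathcal X(x',x)\in\mathcal V_o$ satisfying $e\le\mathcal X(x,x)$ and $\mathcal X(x',x)\otimes\mathcal X(x'',x')\le\mathcal X(x'',x)$; a $\mathcal V$-functor $f:\mathcal X\to\mathcal Y$ is a map on objects with $\mathcal X(x',x)\le\mathcal Y(fx',fx)$. $\mathcal V\text{-}\mathsf{cat}$ is the category of small $\mathcal V$-categories, enriched over itself with hom $[\mathcal Y,\mathcal Z]$ the $\mathcal V$-category of $\mathcal V$-functors with $[\mathcal Y,\mathcal Z](f,g)=\bigwedge_y\mathcal Z(fy,gy)$. $D:\mathsf{Set}\to\mathcal V\text{-}\mathsf{cat}$ sends a set to the discrete $\mathcal V$-category on it (distance $e$ between equal objects, $\bot$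 otherwise), and $\mathsf{Set}$ is $\mathcal V\text{-}\mathsf{cat}$-enriched with discrete homs. For a $\mathcal V$-category $\mathcal X$ with object set $X_{\mathsf o}$ and $r\in\mathcal V_o$, $X_r=\{(x',x)\in X_{\mathsf o}\times X_{\mathsf o}\mid r\le\mathcal X(x',x)\}$ with projections $d^r_0,d^r_1:X_r\to X_{\mathsf o}$. The $\mathcal V\text{-}\mathsf{cat}$-ification $T_{\mathcal V}=\mathrm{Lan}_D(DT)$ is the $\mathcal V\text{-}\mathsf{cat}$-enriched left Kan extension of $DT$ along $D$. Concretely, $T_{\mathcal V}\mathcal X$ has object set $TX_{\mathsf o}$, and $T_{\mathcal V}\mathcal X(A',A)$ is the supremum of all $DTX_{\mathsf o}(A'_0,A_0)\otimes r_1\otimes DTX_{\mathsf o}(A'_1,A_1)\otimes\cdots\otimes r_n\otimes DTX_{\mathsf o}(A'_n,A_n)$ over all $n\ge0$, all pairs $(A'_i,A_i)$ of elements of $TX_{\mathsf o}$ with $A'_0=A'$, $A_n=A$, and all $r_1,\dots,r_n\in\mathcal V_o$ for which there are $C_i\in T(X_{r_i})$ with $Td^{r_i}_0(C_i)=A_{i-1}$ and $Td^{r_i}_1(C_i)=A'_i$. Relation lifting: for a relation $R\subseteq X\times Y$ with projections $p:R\to X$, $q:R\to Y$, $\mathsf{Rel}_T(R)=\{(Tp(C),Tq(C))\mid C\in TR\}\subseteq TX\times TY$. *)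

theory Defs
  imports "HOL-Library.FuncSet"
begin

section \<open>Commutative quantales\<close>

text \<open>The tensor and its unit are written \<open>*\<close> and \<open>1\<close>; \<open>residual r\<close> is the right adjoint \<open>[r,-]\<close>
  of \<open>- * r\<close>. The last axiom is the standing assumption that the quantale is non-trivial.\<close>

class comm_quantale = complete_lattice + comm_monoid_mult +
  fixes residual :: "'a \<Rightarrow> 'a \<Rightarrow> 'a"
  assumes tensor_mono: "a \<le> a' \<Longrightarrow> b \<le> b' \<Longrightarrow> a * b \<le> a' * b'"
    and tensor_adjoint: "a * r \<le> b \<longleftrightarrow> a \<le> residual r b"
    and unit_neq_bot: "1 \<noteq> bot"


section \<open>Categories enriched in a quantale\<close>

text \<open>\<open>Hom X x' x\<close> is \<open>X(x',x)\<close>; its values outside \<open>Obj X\<close> are irrelevant. Functions between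
  sets are always extensional (\<open>\<rightarrow>\<^sub>E\<close>), so that equality of arrows is equality of HOL functions.\<close>

record ('o, 'v) vcat =
  Obj :: "'o set"
  Hom :: "'o \<Rightarrow> 'o \<Rightarrow> 'v"

definition vcategory :: "('o, 'v::comm_quantale) vcat \<Rightarrow> bool" where
  "vcategory X \<longleftrightarrow>
     (\<forall>x\<in>Obj X. 1 \<le> Hom X x x) \<and>
     (\<forall>x\<in>Obj X. \<forall>x'\<in>Obj X. \<forall>x''\<in>Obj X. Hom X x' x * Hom X x'' x' \<le> Hom X x'' x)"

definition vfunctors ::
    "('o, 'v::comm_quantale) vcat \<Rightarrow> ('p, 'v) vcat \<Rightarrow> ('o \<Rightarrow> 'p) set" where
  "vfunctors X Y =
     {f \<in> Obj X \<rightarrow>\<^sub>E Obj Y. \<forall>x'\<in>Obj X. \<forall>x\<in>Obj X. Hom X x' x \<le> Hom Y (f x') (f x)}"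

text \<open>The internal hom \<open>[X,Y]\<close>.\<close>

definition vfun_cat ::
    "('o, 'v::comm_quantale) vcat \<Rightarrow> ('p, 'v) vcat \<Rightarrow> ('o \<Rightarrow> 'p, 'v) vcat" where
  "vfun_cat X Y = \<lparr>Obj = vfunctors X Y, Hom = (\<lambda>f g. INF x\<in>Obj X. Hom Y (f x) (g x))\<rparr>"

definition vcat_iso ::
    "('o, 'v::comm_quantale) vcat \<Rightarrow> ('p, 'v) vcat \<Rightarrow> ('o \<Rightarrow> 'p) \<Rightarrow> bool" where
  "vcat_iso X Y F \<longleftrightarrow>
     bij_betw F (Obj X) (Obj Y) \<and>
     (\<forall>x'\<in>Obj X. \<forall>x\<in>Obj X. Hom X x' x = Hom Y (F x') (F x))"

text \<open>The object part of \<open>D\<close>; on arrows, \<open>D\<close> is the identity.\<close>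

definition discrete :: "'o set \<Rightarrow> ('o, 'v::comm_quantale) vcat" where
  "discrete S = \<lparr>Obj = S, Hom = (\<lambda>x' x. if x' = x then 1 else bot)\<rparr>"


section \<open>Set functors\<close>

text \<open>HOL has no type of all sets. The sets on which a functor acts are the subsets of the type
  \<open>'a elem\<close>, where \<open>'a\<close> is arbitrary; it is closed under pairing, so that a binary relation between
  two such sets is again such a set. The values of the functor are subsets of a second,
  unrelated type \<open>'b\<close>, since they may be larger, as for the powerset functor.\<close>

datatype 'a elem = Atom 'a | Pair (elem_fst: "'a elem") (elem_snd: "'a elem")

record ('a, 'b) set_fun =
  on_set :: "'a elem set \<Rightarrow> 'b set"
  on_map :: "'a elem set \<Rightarrow> 'a elem set \<Rightarrow> ('a elem \<Rightarrow> 'a elem) \<Rightarrow> 'b \<Rightarrow> 'b"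

definition set_functor :: "('a, 'b) set_fun \<Rightarrow> bool" where
  "set_functor T \<longleftrightarrow>
     (\<forall>X Y. \<forall>f \<in> X \<rightarrow>\<^sub>E Y. on_map T X Y f \<in> on_set T X \<rightarrow>\<^sub>E on_set T Y) \<and>
     (\<forall>X. on_map T X X (\<lambda>x\<in>X. x) = (\<lambda>A\<in>on_set T X. A)) \<and>
     (\<forall>X Y Z. \<forall>f \<in> X \<rightarrow>\<^sub>E Y. \<forall>g \<in> Y \<rightarrow>\<^sub>E Z.
        on_map T X Z (compose X g f) = compose (on_set T X) (on_map T Y Z g) (on_map T X Y f))"

definition weak_pullback ::
    "'o set \<Rightarrow> 'o set \<Rightarrow> 'o set \<Rightarrow> 'o set \<Rightarrow>
     ('o \<Rightarrow> 'o) \<Rightarrow> ('o \<Rightarrow> 'o) \<Rightarrow> ('o \<Rightarrow> 'o) \<Rightarrow> ('o \<Rightarrow> 'o) \<Rightarrow> bool" where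
  "weak_pullback P X Y Z p q f g \<longleftrightarrow>
     p \<in> P \<rightarrow>\<^sub>E X \<and> q \<in> P \<rightarrow>\<^sub>E Y \<and> f \<in> X \<rightarrow>\<^sub>E Z \<and> g \<in> Y \<rightarrow>\<^sub>E Z \<and>
     compose P f p = compose P g q \<and>
     (\<forall>Q :: 'o set. \<forall>u \<in> Q \<rightarrow>\<^sub>E X. \<forall>v \<in> Q \<rightarrow>\<^sub>E Y. compose Q f u = compose Q g v \<longrightarrow>
        (\<exists>h \<in> Q \<rightarrow>\<^sub>E P. compose Q p h = u \<and> compose Q q h = v))"

definition preserves_weak_pullbacks :: "('a, 'b) set_fun \<Rightarrow> bool" where
  "preserves_weak_pullbacks T \<longleftrightarrow>
     (\<forall>P X Y Z p q f g. weak_pullback P X Y Z p q f g \<longrightarrow>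
        weak_pullback (on_set T P) (on_set T X) (on_set T Y) (on_set T Z)
          (on_map T P X p) (on_map T P Y q) (on_map T X Z f) (on_map T Y Z g))"

text \<open>\<open>Rel\<^sub>T(R)\<close> for a relation \<open>R\<close> between \<open>X\<close> and \<open>Y\<close>, given as a set of \<open>Pair x y\<close>
  with \<open>x \<in> X\<close> and \<open>y \<in> Y\<close>.\<close>

definition rel_lift ::
    "('a, 'b) set_fun \<Rightarrow> 'a elem set \<Rightarrow> 'a elem set \<Rightarrow> 'a elem set \<Rightarrow> ('b \<times> 'b) set" where
  "rel_lift T X Y R =
     {(on_map T R X (restrict elem_fst R) C, on_map T R Y (restrict elem_snd R) C) | C.
        C \<in> on_set T R}"

text \<open>The relation \<open>X\<^sub>r\<close>.\<close>

definition level :: "('a elem, 'v::comm_quantale) vcat \<Rightarrow> 'v \<Rightarrow> 'a elem set" where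
  "level X r = {Pair x' x | x' x. x' \<in> Obj X \<and> x \<in> Obj X \<and> r \<le> Hom X x' x}"


section \<open>Left Kan extensions along the discrete functor\<close>

record ('o, 'p, 'v) vcat_fun =
  on_vcat :: "('o, 'v) vcat \<Rightarrow> ('p, 'v) vcat"
  on_vfun :: "('o, 'v) vcat \<Rightarrow> ('o, 'v) vcat \<Rightarrow> ('o \<Rightarrow> 'o) \<Rightarrow> 'p \<Rightarrow> 'p"

text \<open>Functors enriched over \<open>V-cat\<close>: the action on arrows is itself a \<open>V\<close>-functor
  \<open>[X,Y] \<rightarrow> [FX,FY]\<close>.\<close>

definition vcat_functor :: "('o, 'p, 'v::comm_quantale) vcat_fun \<Rightarrow> bool" where
  "vcat_functor F \<longleftrightarrow>
     (\<forall>X. vcategory X \<longrightarrow> vcategory (on_vcat F X)) \<and>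
     (\<forall>X Y. vcategory X \<longrightarrow> vcategory Y \<longrightarrow>
        on_vfun F X Y \<in> vfunctors (vfun_cat X Y) (vfun_cat (on_vcat F X) (on_vcat F Y))) \<and>
     (\<forall>X. vcategory X \<longrightarrow> on_vfun F X X (\<lambda>x\<in>Obj X. x) = (\<lambda>x\<in>Obj (on_vcat F X). x)) \<and>
     (\<forall>X Y Z. vcategory X \<longrightarrow> vcategory Y \<longrightarrow> vcategory Z \<longrightarrow>
        (\<forall>f \<in> vfunctors X Y. \<forall>g \<in> vfunctors Y Z.
           on_vfun F X Z (compose (Obj X) g f) =
             compose (Obj (on_vcat F X)) (on_vfun F Y Z g) (on_vfun F X Y f)))"

text \<open>Natural transformations \<open>DT \<Rightarrow> LD\<close>. As \<open>Set\<close> has discrete homs and \<open>V\<close>-functors are determined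
  by their object maps, enriched and ordinary naturality coincide.\<close>

definition kan_unit ::
    "('a, 'b) set_fun \<Rightarrow> ('a elem, 'c, 'v::comm_quantale) vcat_fun \<Rightarrow>
     ('a elem set \<Rightarrow> 'b \<Rightarrow> 'c) \<Rightarrow> bool" where
  "kan_unit T L \<eta> \<longleftrightarrow>
     (\<forall>S. \<eta> S \<in> vfunctors (discrete (on_set T S)) (on_vcat L (discrete S))) \<and>
     (\<forall>S S'. \<forall>h \<in> S \<rightarrow>\<^sub>E S'.
        compose (on_set T S) (on_vfun L (discrete S) (discrete S') h) (\<eta> S) =
        compose (on_set T S) (\<eta> S') (on_map T S S' h))"

text \<open>The \<open>V\<close>-category of enriched natural transformations from \<open>V-cat(D-,X)\<close> to \<open>V-cat(DT-,Z)\<close>,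
  both regarded as functors from the opposite of \<open>Set\<close> to \<open>V-cat\<close>; that is, of the cocones on
  \<open>DT\<close> with weight \<open>V-cat(D-,X)\<close> and vertex \<open>Z\<close>.\<close>

definition weighted_cocones ::
    "('a, 'b) set_fun \<Rightarrow> ('a elem, 'v::comm_quantale) vcat \<Rightarrow> ('z, 'v) vcat \<Rightarrow>
     ('a elem set \<Rightarrow> ('a elem \<Rightarrow> 'a elem) \<Rightarrow> 'b \<Rightarrow> 'z, 'v) vcat" where
  "weighted_cocones T X Z =
     \<lparr>Obj = {\<phi>.
        (\<forall>S. \<phi> S \<in> vfunctors (vfun_cat (discrete S) X) (vfun_cat (discrete (on_set T S)) Z)) \<and>
        (\<forall>S S'. \<forall>h \<in> S' \<rightarrow>\<^sub>E S. \<forall>f \<in> vfunctors (discrete S) X.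
           \<phi> S' (compose S' f h) = compose (on_set T S') (\<phi> S f) (on_map T S' S h))},
      Hom = (\<lambda>\<phi> \<psi>. INF S.
        Hom (vfun_cat (vfun_cat (discrete S) X) (vfun_cat (discrete (on_set T S)) Z)) (\<phi> S) (\<psi> S))\<rparr>"

text \<open>\<open>L\<close> with unit \<open>\<eta>\<close> is the enriched left Kan extension of \<open>DT\<close> along \<open>D\<close>, in the (pointwise)
  sense of Kelly: for every \<open>X\<close>, the value \<open>L X\<close> is the colimit of \<open>DT\<close> weighted by \<open>V-cat(D-,X)\<close>,
  with universal cocone \<open>f \<mapsto> L f \<circ> \<eta> S\<close> for \<open>f : D S \<rightarrow> X\<close>. The vertex \<open>Z\<close> ranges over the
  \<open>V\<close>-categories with objects in an arbitrary type \<open>'z\<close>, passed as an argument.\<close>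

definition left_kan_along_discrete ::
    "'z itself \<Rightarrow> ('a, 'b) set_fun \<Rightarrow> ('a elem, 'c, 'v::comm_quantale) vcat_fun \<Rightarrow>
     ('a elem set \<Rightarrow> 'b \<Rightarrow> 'c) \<Rightarrow> bool" where
  "left_kan_along_discrete _ T L \<eta> \<longleftrightarrow>
     vcat_functor L \<and> kan_unit T L \<eta> \<and>
     (\<forall>X (Z :: ('z, 'v) vcat). vcategory X \<longrightarrow> vcategory Z \<longrightarrow>
        vcat_iso (vfun_cat (on_vcat L X) Z) (weighted_cocones T X Z)
          (\<lambda>k S. \<lambda>f \<in> vfunctors (discrete S) X.
             compose (on_set T S) k
               (compose (on_set T S) (on_vfun L (discrete S) X f) (\<eta> S))))"


section \<open>The V-cat-ification of a set functor\<close>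

text \<open>The set whose supremum is \<open>T\<^sub>V X(A',A)\<close>. The sequences \<open>a'\<close>, \<open>a\<close>, \<open>r\<close> are only used at the
  indices \<open>0..n\<close>, respectively \<open>1..n\<close>; since the tensor is commutative, the product is
  written with \<open>\<Prod>\<close>.\<close>

definition chain_values ::
    "('a, 'b) set_fun \<Rightarrow> ('a elem, 'v::comm_quantale) vcat \<Rightarrow> 'b \<Rightarrow> 'b \<Rightarrow> 'v set" where
  "chain_values T X A' A =
     {Hom (discrete (on_set T (Obj X))) (a' 0) (a 0) *
        (\<Prod>i=1..n. r i * Hom (discrete (on_set T (Obj X))) (a' i) (a i)) | (n::nat) a' a r.
        a' 0 = A' \<and> a n = A \<and>
        (\<forall>i\<le>n. a' i \<in> on_set T (Obj X) \<and> a i \<in> on_set T (Obj X)) \<and>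
        (\<forall>i\<in>{1..n}. \<exists>C \<in> on_set T (level X (r i)).
           on_map T (level X (r i)) (Obj X) (restrict elem_fst (level X (r i))) C = a (i - 1) \<and>
           on_map T (level X (r i)) (Obj X) (restrict elem_snd (level X (r i))) C = a' i)}"

definition vcatification :: "('a, 'b) set_fun \<Rightarrow> ('a elem, 'b, 'v::comm_quantale) vcat_fun" where
  "vcatification T =
     \<lparr>on_vcat = (\<lambda>X. \<lparr>Obj = on_set T (Obj X), Hom = (\<lambda>A' A. Sup (chain_values T X A' A))\<rparr>),
      on_vfun = (\<lambda>X Y. \<lambda>f \<in> vfunctors X Y. on_map T (Obj X) (Obj Y) f)\<rparr>"

end

theory Submission imports Defs begin

text \<open>Weak pullback preservation makes \<open>Rel\<^sub>T\<close> compatible with relational composition, so a chain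
  whose discrete links are not \<open>\<bottom>\<close> collapses: if its steps lie in the liftings of the levels
  \<open>r\<^sub>1, \<dots>, r\<^sub>n\<close>, then its end points lie in \<open>Rel\<^sub>T(X\<^sub>s)\<close> for \<open>s = r\<^sub>1 \<otimes> \<dots> \<otimes> r\<^sub>n\<close>. For the Kan
  extension, evaluation at the identity of \<open>X\<^sub>o\<close> inverts the comparison map: by naturality a cocone
  \<open>\<phi>\<close> is determined by \<open>k = \<phi>(id)\<close>, and enrichment of \<open>\<phi>\<close> at the pair of projections
  \<open>X\<^sub>r \<rightarrow> X\<^sub>o\<close>, for all \<open>r\<close>, makes \<open>k\<close> a \<open>V\<close>-functor on \<open>T\<^sub>V X\<close>.\<close>

section \<open>Tensor, bottom and suprema in a quantale\<close>

text \<open>Tensoring with a fixed element is a left adjoint and so preserves the bottom. This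
  annihilates every chain with a broken discrete link.\<close>

lemma bot_tensor [simp]:
  fixes a :: "'v::comm_quantale"
  shows "bot * a = bot" "a * bot = bot"
proof -
  show "bot * a = bot"
    using tensor_adjoint[of bot a bot] by (simp add: bot_unique)
  then show "a * bot = bot"
    by (simp add: mult.commute)
qed

text \<open>Residuating one factor at a time reduces a bound on a product of suprema to bounds on
  products of members. It serves the triangle inequality of
  \<open>on_vcat (vcatification T) X\<close>.\<close>

lemma Sup_tensor_le:
  fixes z :: "'v::comm_quantale"
  assumes "\<And>a b. a \<in> S \<Longrightarrow> b \<in> S' \<Longrightarrow> a * b \<le> z"
  shows "Sup S * Sup S' \<le> z"
proof -
  have "a * Sup S' \<le> z" if "a \<in> S" for a
  proof -
    have "Sup S' \<le> residual a z"
      using assms[OF that] by (intro Sup_least) (simp add: tensor_adjoint[symmetric] mult.commute)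
    then show ?thesis
      by (simp add: tensor_adjoint[symmetric] mult.commute)
  qed
  then have "Sup S \<le> residual (Sup S') z"
    by (intro Sup_least) (simp add: tensor_adjoint[symmetric])
  then show ?thesis
    by (simp add: tensor_adjoint)
qed

section \<open>Set functors and relation lifting\<close>

lemma on_map_funcset:
  assumes "set_functor T" "f \<in> X \<rightarrow>\<^sub>E Y"
  shows "on_map T X Y f \<in> on_set T X \<rightarrow>\<^sub>E on_set T Y"
  using assms by (simp add: set_functor_def)

lemma on_map_in:
  assumes "set_functor T" "f \<in> X \<rightarrow>\<^sub>E Y" "A \<in> on_set T X"
  shows "on_map T X Y f A \<in> on_set T Y"
  using on_map_funcset[OF assms(1,2)] assms(3) by auto

lemma on_map_id:
  assumes "set_functor T"
  shows "on_map T X X (\<lambda>x\<in>X. x) = (\<lambda>A\<in>on_set T X. A)"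
  using assms by (simp add: set_functor_def)

lemma on_map_compose:
  assumes "set_functor T" "f \<in> X \<rightarrow>\<^sub>E Y" "g \<in> Y \<rightarrow>\<^sub>E Z"
  shows "on_map T X Z (compose X g f) = compose (on_set T X) (on_map T Y Z g) (on_map T X Y f)"
  using assms unfolding set_functor_def by blast

lemma on_map_compose_apply:
  assumes "set_functor T" "f \<in> X \<rightarrow>\<^sub>E Y" "g \<in> Y \<rightarrow>\<^sub>E Z" "A \<in> on_set T X" "compose X g f = h"
  shows "on_map T Y Z g (on_map T X Y f A) = on_map T X Z h A"
  using on_map_compose[OF assms(1-3)] assms(4,5) by (simp add: compose_def)

text \<open>The pairing of \<open>f\<close> and \<open>g\<close> maps \<open>S\<close> into
  \<open>R\<close>, and the projections of \<open>R\<close> recover both maps from it. The image of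
  \<open>A\<close> under the lifted pairing is therefore the required witness in
  \<open>on_set T R\<close>.\<close>

lemma rel_lift_on_map:
  assumes T: "set_functor T" and f: "f \<in> S \<rightarrow>\<^sub>E X" and g: "g \<in> S \<rightarrow>\<^sub>E Y"
    and R: "R \<subseteq> {Pair x y | x y. x \<in> X \<and> y \<in> Y}"
    and fg: "\<And>x. x \<in> S \<Longrightarrow> Pair (f x) (g x) \<in> R" and A: "A \<in> on_set T S"
  shows "(on_map T S X f A, on_map T S Y g A) \<in> rel_lift T X Y R"
proof -
  let ?m = "\<lambda>x\<in>S. Pair (f x) (g x)"
  have m: "?m \<in> S \<rightarrow>\<^sub>E R"
    using fg by auto
  have d: "restrict elem_fst R \<in> R \<rightarrow>\<^sub>E X" "restrict elem_snd R \<in> R \<rightarrow>\<^sub>E Y"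
    using R by auto
  have "compose S (restrict elem_fst R) ?m = f"
    using f fg by (intro extensionalityI[of _ S]) (auto simp: compose_def PiE_def)
  moreover have "compose S (restrict elem_snd R) ?m = g"
    using g fg by (intro extensionalityI[of _ S]) (auto simp: compose_def PiE_def)
  ultimately have
    "on_map T R X (restrict elem_fst R) (on_map T S R ?m A) = on_map T S X f A"
    "on_map T R Y (restrict elem_snd R) (on_map T S R ?m A) = on_map T S Y g A"
    using on_map_compose_apply[OF T m _ A] d by blast+
  moreover have "on_map T S R ?m A \<in> on_set T R"
    by (rule on_map_in[OF T m A])
  ultimately show ?thesis
    unfolding rel_lift_def by (smt (verit) mem_Collect_eq)
qed

text \<open>Witnesses \<open>G\<close> and \<open>H\<close> that agree over \<open>Y\<close> come
  from a single element of \<open>T\<close> applied to the pullback of \<open>R\<close> and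
  \<open>S\<close>, and the two outer projections map this pullback into \<open>U\<close>.
  Containment of the composite in \<open>U\<close> suits levels, where
  \<open>level X (r * s)\<close> can exceed the composite of \<open>level X r\<close> and
  \<open>level X s\<close>.\<close>

lemma rel_lift_relcomp:
  assumes T: "set_functor T" "preserves_weak_pullbacks T"
    and R: "R \<subseteq> {Pair x y | x y. x \<in> X \<and> y \<in> Y}"
    and S: "S \<subseteq> {Pair y z | y z. y \<in> Y \<and> z \<in> Z}"
    and U: "U \<subseteq> {Pair x z | x z. x \<in> X \<and> z \<in> Z}"
    and RSU: "\<And>x y z. Pair x y \<in> R \<Longrightarrow> Pair y z \<in> S \<Longrightarrow> Pair x z \<in> U"
    and AB: "(A, B) \<in> rel_lift T X Y R" and BC: "(B, C) \<in> rel_lift T Y Z S"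
  shows "(A, C) \<in> rel_lift T X Z U"
proof -
  obtain G where G: "G \<in> on_set T R" "A = on_map T R X (restrict elem_fst R) G"
      "B = on_map T R Y (restrict elem_snd R) G"
    using AB unfolding rel_lift_def by auto
  obtain H where H: "H \<in> on_set T S" "B = on_map T S Y (restrict elem_fst S) H"
      "C = on_map T S Z (restrict elem_snd S) H"
    using BC unfolding rel_lift_def by auto
  \<comment> \<open>The canonical pullback of \<open>elem_snd\<close> on \<open>R\<close> and
    \<open>elem_fst\<close> on \<open>S\<close>, encoded by \<open>Pair\<close> so that it is again
    a set on which \<open>T\<close> acts.\<close>
  define P where "P = {Pair g h | g h. g \<in> R \<and> h \<in> S \<and> elem_snd g = elem_fst h}"
  let ?p = "restrict elem_fst P" and ?q = "restrict elem_snd P"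
  have p: "?p \<in> P \<rightarrow>\<^sub>E R" and q: "?q \<in> P \<rightarrow>\<^sub>E S"
    by (auto simp: P_def)
  have dR: "restrict elem_fst R \<in> R \<rightarrow>\<^sub>E X" "restrict elem_snd R \<in> R \<rightarrow>\<^sub>E Y"
    using R by auto
  have dS: "restrict elem_fst S \<in> S \<rightarrow>\<^sub>E Y" "restrict elem_snd S \<in> S \<rightarrow>\<^sub>E Z"
    using S by auto
  have "weak_pullback P R S Y ?p ?q (restrict elem_snd R) (restrict elem_fst S)"
    unfolding weak_pullback_def
  proof (intro conjI allI ballI impI)
    show "compose P (restrict elem_snd R) ?p = compose P (restrict elem_fst S) ?q"
      unfolding compose_def by (intro restrict_ext) (auto simp: P_def)
  next
    fix Q u v
    assume u: "u \<in> Q \<rightarrow>\<^sub>E R" and v: "v \<in> Q \<rightarrow>\<^sub>E S"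
      and uv: "compose Q (restrict elem_snd R) u = compose Q (restrict elem_fst S) v"
    have eq: "elem_snd (u x) = elem_fst (v x)" if "x \<in> Q" for x
      using fun_cong[OF uv, of x] that u v by (auto simp: compose_def PiE_iff)
    have P: "Pair (u x) (v x) \<in> P" if "x \<in> Q" for x
      using eq[OF that] that u v by (auto simp: P_def PiE_iff)
    show "\<exists>h\<in>Q \<rightarrow>\<^sub>E P. compose Q ?p h = u \<and> compose Q ?q h = v"
    proof (intro bexI[of _ "\<lambda>x\<in>Q. Pair (u x) (v x)"] conjI)
      show "compose Q ?p (\<lambda>x\<in>Q. Pair (u x) (v x)) = u"
        using u P by (intro extensionalityI[of _ Q]) (auto simp: compose_def PiE_def)
      show "compose Q ?q (\<lambda>x\<in>Q. Pair (u x) (v x)) = v"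
        using v P by (intro extensionalityI[of _ Q]) (auto simp: compose_def PiE_def)
    qed (use P in auto)
  qed (use p q dR dS in auto)
  with T(2) have wp: "weak_pullback (on_set T P) (on_set T R) (on_set T S) (on_set T Y)
      (on_map T P R ?p) (on_map T P S ?q)
      (on_map T R Y (restrict elem_snd R)) (on_map T S Y (restrict elem_fst S))"
    unfolding preserves_weak_pullbacks_def by blast
  \<comment> \<open>Test objects for the lifted square are subsets of \<open>'b\<close>. The
    singleton \<open>{G}\<close> serves as a one-point set, whose maps are elements; the mediating
    map then picks out a common preimage of \<open>G\<close> and \<open>H\<close>.\<close>
  let ?u = "\<lambda>x\<in>{G}. G" and ?v = "\<lambda>x\<in>{G}. H"
  have "?u \<in> {G} \<rightarrow>\<^sub>E on_set T R" "?v \<in> {G} \<rightarrow>\<^sub>E on_set T S"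
    using G(1) H(1) by auto
  moreover have "compose {G} (on_map T R Y (restrict elem_snd R)) ?u =
      compose {G} (on_map T S Y (restrict elem_fst S)) ?v"
    using G(3) H(2) by (auto simp: compose_def)
  ultimately obtain h where h: "h \<in> {G} \<rightarrow>\<^sub>E on_set T P"
      "compose {G} (on_map T P R ?p) h = ?u" "compose {G} (on_map T P S ?q) h = ?v"
    using wp unfolding weak_pullback_def by metis
  define E where "E = h G"
  have E: "E \<in> on_set T P" "on_map T P R ?p E = G" "on_map T P S ?q E = H"
    using h(1) fun_cong[OF h(2), of G] fun_cong[OF h(3), of G]
    by (auto simp: E_def compose_def)
  let ?f = "compose P (restrict elem_fst R) ?p" and ?g = "compose P (restrict elem_snd S) ?q"
  have f: "?f \<in> P \<rightarrow>\<^sub>E X" and g: "?g \<in> P \<rightarrow>\<^sub>E Z"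
    using p q dR dS by (auto simp: compose_def PiE_iff)
  have "Pair (?f x) (?g x) \<in> U" if x: "x \<in> P" for x
  proof -
    obtain g h where gh: "x = Pair g h" "g \<in> R" "h \<in> S" "elem_snd g = elem_fst h"
      using x by (auto simp: P_def)
    have "g = Pair (elem_fst g) (elem_snd g)" "h = Pair (elem_fst h) (elem_snd h)"
      using gh(2,3) R S by auto
    with RSU gh have "Pair (elem_fst g) (elem_snd h) \<in> U"
      by metis
    with x gh show ?thesis
      by (simp add: compose_def)
  qed
  from rel_lift_on_map[OF T(1) f g U this E(1)]
  have "(on_map T P X ?f E, on_map T P Z ?g E) \<in> rel_lift T X Z U" .
  moreover have "on_map T P X ?f E = A"
    using on_map_compose_apply[OF T(1) p dR(1) E(1) refl] E(2) G(2) by simp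
  moreover have "on_map T P Z ?g E = C"
    using on_map_compose_apply[OF T(1) q dS(2) E(1) refl] E(3) H(3) by simp
  ultimately show ?thesis
    by simp
qed

section \<open>Lifting the levels of a \<open>V\<close>-category\<close>

lemma level_subset: "level X r \<subseteq> {Pair x y | x y. x \<in> Obj X \<and> y \<in> Obj X}"
  by (auto simp: level_def)

lemma rel_lift_level_in:
  assumes T: "set_functor T" and "(A', A) \<in> rel_lift T (Obj X) (Obj X) (level X s)"
  shows "A' \<in> on_set T (Obj X)" "A \<in> on_set T (Obj X)"
proof -
  have d: "restrict elem_fst (level X s) \<in> level X s \<rightarrow>\<^sub>E Obj X"
    "restrict elem_snd (level X s) \<in> level X s \<rightarrow>\<^sub>E Obj X"
    by (auto simp: level_def)
  show "A' \<in> on_set T (Obj X)" "A \<in> on_set T (Obj X)"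
    using assms(2) on_map_in[OF T d(1)] on_map_in[OF T d(2)] by (auto simp: rel_lift_def)
qed

lemma rel_lift_level_one:
  assumes T: "set_functor T" and X: "vcategory X" and A: "A \<in> on_set T (Obj X)"
  shows "(A, A) \<in> rel_lift T (Obj X) (Obj X) (level X 1)"
proof -
  let ?id = "\<lambda>x\<in>Obj X. x"
  have id: "?id \<in> Obj X \<rightarrow>\<^sub>E Obj X"
    by auto
  have "Pair (?id x) (?id x) \<in> level X 1" if "x \<in> Obj X" for x
    using that X by (auto simp: level_def vcategory_def)
  from rel_lift_on_map[OF T id id level_subset this A] show ?thesis
    using A unfolding on_map_id[OF T] by simp
qed

text \<open>The triangle inequality puts the composite of \<open>level X r\<close> and
  \<open>level X s\<close> inside \<open>level X (r * s)\<close>, so composition of lifted relations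
  applies.\<close>

lemma rel_lift_level_mult:
  assumes T: "set_functor T" "preserves_weak_pullbacks T" and X: "vcategory X"
    and "(A, B) \<in> rel_lift T (Obj X) (Obj X) (level X r)"
    and "(B, C) \<in> rel_lift T (Obj X) (Obj X) (level X s)"
  shows "(A, C) \<in> rel_lift T (Obj X) (Obj X) (level X (r * s))"
proof (rule rel_lift_relcomp[OF T level_subset level_subset level_subset _ assms(4,5)])
  fix x y z
  assume xy: "Pair x y \<in> level X r" and yz: "Pair y z \<in> level X s"
  \<comment> \<open>The triangle inequality in \<open>vcategory\<close> lists the later arrow first;
    commutativity restores \<open>r * s\<close>.\<close>
  have "s * r \<le> Hom X y z * Hom X x y"
    using xy yz by (intro tensor_mono) (auto simp: level_def)
  also have "\<dots> \<le> Hom X x z"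
    using X xy yz by (auto simp: vcategory_def level_def)
  finally show "Pair x z \<in> level X (r * s)"
    using xy yz by (auto simp: level_def mult.commute)
qed

section \<open>The V-cat-ification\<close>

lemma Obj_vcatification [simp]: "Obj (on_vcat (vcatification T) X) = on_set T (Obj X)"
  by (simp add: vcatification_def)

lemma vfun_cat_simps [simp]:
  "Obj (vfun_cat X Y) = vfunctors X Y"
  "Hom (vfun_cat X Y) f g = (INF x\<in>Obj X. Hom Y (f x) (g x))"
  by (simp_all add: vfun_cat_def)

lemma Obj_discrete [simp]: "Obj (discrete S) = S"
  by (simp add: discrete_def)

lemma Hom_discrete: "Hom (discrete S) x y = (if x = y then 1 else bot)"
  by (simp add: discrete_def)

section \<open>Collapse of chains and the formula for the distances\<close>

text \<open>Induction on the length shows that the value of a chain is itself a level whose lifting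
  relates the end points, unless a link is broken. That case gives \<open>bot\<close> as a separate
  alternative: the end points may then fail to be related even by the lifting of
  \<open>level X bot\<close>.\<close>

lemma chain_value_le:
  fixes X :: "('a elem, 'v::comm_quantale) vcat" and r :: "nat \<Rightarrow> 'v"
  assumes T: "set_functor T" "preserves_weak_pullbacks T" and X: "vcategory X"
    and "a' 0 \<in> on_set T (Obj X)"
    and "\<forall>i\<in>{1..n}. (a (i - 1), a' i) \<in> rel_lift T (Obj X) (Obj X) (level X (r i))"
  shows "Hom (discrete (on_set T (Obj X))) (a' 0) (a 0) *
      (\<Prod>i=1..n. r i * Hom (discrete (on_set T (Obj X))) (a' i) (a i))
    \<in> {bot} \<union> {s. (a' 0, a n) \<in> rel_lift T (Obj X) (Obj X) (level X s)}"
  using assms(5)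
proof (induction n)
  \<comment> \<open>The product is empty and only the initial link remains: it is \<open>1\<close>
    between equal elements and \<open>bot\<close> otherwise.\<close>
  case 0
  then show ?case
    using rel_lift_level_one[OF T(1) X assms(4)] by (auto simp: Hom_discrete)
next
  case (Suc n)
  define w where "w = Hom (discrete (on_set T (Obj X))) (a' 0) (a 0) *
      (\<Prod>i=1..n. r i * Hom (discrete (on_set T (Obj X))) (a' i) (a i))"
  have step: "(a n, a' (Suc n)) \<in> rel_lift T (Obj X) (Obj X) (level X (r (Suc n)))"
    using Suc.prems[rule_format, of "Suc n"] by simp
  have w: "w = bot \<or> (a' 0, a n) \<in> rel_lift T (Obj X) (Obj X) (level X w)"
    using Suc by (simp add: w_def)
  have eq: "Hom (discrete (on_set T (Obj X))) (a' 0) (a 0) *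
      (\<Prod>i=1..Suc n. r i * Hom (discrete (on_set T (Obj X))) (a' i) (a i)) =
      w * r (Suc n) * Hom (discrete (on_set T (Obj X))) (a' (Suc n)) (a (Suc n))"
    by (simp add: w_def mult.assoc)
  show ?case
  \<comment> \<open>Either the new value is \<open>bot\<close>, or the last link is an equality with
    factor \<open>1\<close> and the lifted levels \<open>w\<close> and \<open>r (Suc n)\<close>
    compose.\<close>
  proof (cases "w = bot \<or> a' (Suc n) \<noteq> a (Suc n)")
    case True
    then show ?thesis
      unfolding eq by (auto simp: Hom_discrete)
  next
    case False
    then show ?thesis
      unfolding eq using w step rel_lift_level_mult[OF T X] by (simp add: Hom_discrete)
  qed
qed

text \<open>Each chain value is \<open>bot\<close> or belongs to the set on the right, and each
  member of that set is the value of a chain with one step.\<close>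

lemma Hom_vcatification:
  fixes X :: "('a elem, 'v::comm_quantale) vcat"
  assumes T: "set_functor T" "preserves_weak_pullbacks T" and X: "vcategory X"
  shows "Hom (on_vcat (vcatification T) X) A' A =
    Sup {s. (A', A) \<in> rel_lift T (Obj X) (Obj X) (level X s)}" (is "_ = Sup ?S")
proof -
  have "Sup (chain_values T X A' A) = Sup ?S"
  proof (rule antisym)
    show "Sup (chain_values T X A' A) \<le> Sup ?S"
    proof (rule Sup_least)
      fix v assume "v \<in> chain_values T X A' A"
      then obtain n :: nat and a' a r where v: "v = Hom (discrete (on_set T (Obj X))) (a' 0) (a 0) *
          (\<Prod>i=1..n. r i * Hom (discrete (on_set T (Obj X))) (a' i) (a i))"
        and a: "a' 0 = A'" "a n = A" "\<forall>i\<le>n. a' i \<in> on_set T (Obj X) \<and> a i \<in> on_set T (Obj X)"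
        and C: "\<forall>i\<in>{1..n}. \<exists>C \<in> on_set T (level X (r i)).
           on_map T (level X (r i)) (Obj X) (restrict elem_fst (level X (r i))) C = a (i - 1) \<and>
           on_map T (level X (r i)) (Obj X) (restrict elem_snd (level X (r i))) C = a' i"
        unfolding chain_values_def by blast
      have "\<forall>i\<in>{1..n}. (a (i - 1), a' i) \<in> rel_lift T (Obj X) (Obj X) (level X (r i))"
        using C unfolding rel_lift_def by (smt (verit, best) mem_Collect_eq)
      with a have "v \<in> {bot} \<union> ?S"
        using chain_value_le[OF T X, of a' n a r] unfolding v by auto
      then show "v \<le> Sup ?S"
        by (auto intro: Sup_upper)
    qed
    show "Sup ?S \<le> Sup (chain_values T X A' A)"
    proof (rule Sup_subset_mono, rule subsetI)
      fix s assume "s \<in> ?S"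
      then have s: "(A', A) \<in> rel_lift T (Obj X) (Obj X) (level X s)"
        by simp
      \<comment> \<open>One function serves for both sequences: \<open>a' 0 = a 0 = A'\<close> and
        \<open>a' 1 = a 1 = A\<close>, with \<open>r 1 = s\<close>, so both discrete links are
        \<open>1\<close>.\<close>
      then show "s \<in> chain_values T X A' A"
        unfolding chain_values_def mem_Collect_eq using rel_lift_level_in[OF T(1) s]
        by (intro exI[of _ "1::nat"] exI[of _ "\<lambda>i. if i = 0 then A' else A"] exI[of _ "\<lambda>_. s"])
          (auto simp: rel_lift_def Hom_discrete)
    qed
  qed
  then show ?thesis
    by (simp add: vcatification_def)
qed

lemma le_Hom_vcatification:
  assumes T: "set_functor T" "preserves_weak_pullbacks T" and X: "vcategory X"
    and "(A', A) \<in> rel_lift T (Obj X) (Obj X) (level X s)"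
  shows "s \<le> Hom (on_vcat (vcatification T) X) A' A"
  using assms(4) by (auto simp: Hom_vcatification[OF T X] intro: Sup_upper)

lemma vcategory_vcatification:
  assumes T: "set_functor T" "preserves_weak_pullbacks T" and X: "vcategory X"
  shows "vcategory (on_vcat (vcatification T) X)"
  unfolding vcategory_def
proof (intro conjI ballI)
  fix A assume "A \<in> Obj (on_vcat (vcatification T) X)"
  then show "1 \<le> Hom (on_vcat (vcatification T) X) A A"
    by (intro le_Hom_vcatification[OF T X] rel_lift_level_one[OF T(1) X]) simp
next
  fix A A' A''
  show "Hom (on_vcat (vcatification T) X) A' A * Hom (on_vcat (vcatification T) X) A'' A'
    \<le> Hom (on_vcat (vcatification T) X) A'' A"
    unfolding Hom_vcatification[OF T X, of A' A] Hom_vcatification[OF T X, of A'' A']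
  proof (rule Sup_tensor_le)
    fix r s
    assume "r \<in> {r. (A', A) \<in> rel_lift T (Obj X) (Obj X) (level X r)}"
      and "s \<in> {s. (A'', A') \<in> rel_lift T (Obj X) (Obj X) (level X s)}"
    then show "r * s \<le> Hom (on_vcat (vcatification T) X) A'' A"
      using rel_lift_level_mult[OF T X, of A'' A' s A r]
      by (auto simp: mult.commute intro: le_Hom_vcatification[OF T X])
  qed
qed

text \<open>This is the enrichment of \<open>T\<^sub>V\<close>: the pairing \<open>x \<mapsto> (f x, g x)\<close> factors through \<open>X\<^sub>r\<close> for
  \<open>r = [S,X](f,g)\<close>.\<close>

lemma INF_Hom_le_Hom_on_map:
  assumes T: "set_functor T" "preserves_weak_pullbacks T" and X: "vcategory X"
    and f: "f \<in> S \<rightarrow>\<^sub>E Obj X" and g: "g \<in> S \<rightarrow>\<^sub>E Obj X" and A: "A \<in> on_set T S"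
  shows "(INF x\<in>S. Hom X (f x) (g x)) \<le>
    Hom (on_vcat (vcatification T) X) (on_map T S (Obj X) f A) (on_map T S (Obj X) g A)"
proof (intro le_Hom_vcatification[OF T X] rel_lift_on_map[OF T(1) f g level_subset _ A])
  fix x assume "x \<in> S"
  then show "Pair (f x) (g x) \<in> level X (INF x\<in>S. Hom X (f x) (g x))"
    using f g by (auto simp: level_def intro: INF_lower)
qed

section \<open>\<open>V\<close>-functors and enriched functoriality\<close>

lemma vfunctors_funcset: "f \<in> vfunctors X Y \<Longrightarrow> f \<in> Obj X \<rightarrow>\<^sub>E Obj Y"
  by (simp add: vfunctors_def)

lemma vfunctors_Hom_le:
  "f \<in> vfunctors X Y \<Longrightarrow> x' \<in> Obj X \<Longrightarrow> x \<in> Obj X \<Longrightarrow> Hom X x' x \<le> Hom Y (f x') (f x)"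
  by (simp add: vfunctors_def)

text \<open>Off-diagonal distances are \<open>bot\<close>, so the only condition left is reflexivity
  in \<open>X\<close>.\<close>

lemma vfunctors_discrete:
  assumes "vcategory X"
  shows "vfunctors (discrete S) X = S \<rightarrow>\<^sub>E Obj X"
  using assms by (fastforce simp: vfunctors_def Hom_discrete vcategory_def)

lemma vcategory_discrete: "vcategory (discrete S)"
  by (auto simp: vcategory_def Hom_discrete)

lemma vfunctors_compose:
  assumes f: "f \<in> vfunctors X Y" and g: "g \<in> vfunctors Y Z"
  shows "compose (Obj X) g f \<in> vfunctors X Z"
proof -
  have fX: "f x \<in> Obj Y" if "x \<in> Obj X" for x
    using vfunctors_funcset[OF f] that by auto
  have "Hom X x' x \<le> Hom Z (g (f x')) (g (f x))" if "x' \<in> Obj X" "x \<in> Obj X" for x' x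
    using vfunctors_Hom_le[OF f that] vfunctors_Hom_le[OF g fX fX] that by (meson order_trans)
  then show ?thesis
    using fX vfunctors_funcset[OF g] by (auto simp: vfunctors_def compose_def)
qed

text \<open>Following the two projections of \<open>level X s\<close> by \<open>f\<close> gives maps
  into \<open>Obj Y\<close> at distance at least \<open>s\<close>. The bound
  \<open>INF_Hom_le_Hom_on_map\<close>, taken over \<open>level X s\<close>, carries this to the
  images of a witness.\<close>

lemma on_map_vfunctor:
  assumes T: "set_functor T" "preserves_weak_pullbacks T"
    and X: "vcategory X" and Y: "vcategory Y" and f: "f \<in> vfunctors X Y"
  shows "on_map T (Obj X) (Obj Y) f \<in>
    vfunctors (on_vcat (vcatification T) X) (on_vcat (vcatification T) Y)"
proof -
  note fXY = vfunctors_funcset[OF f]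
  have "Hom (on_vcat (vcatification T) X) A' A \<le> Hom (on_vcat (vcatification T) Y)
      (on_map T (Obj X) (Obj Y) f A') (on_map T (Obj X) (Obj Y) f A)" for A' A
    unfolding Hom_vcatification[OF T X]
  proof (rule Sup_least)
    fix s assume "s \<in> {s. (A', A) \<in> rel_lift T (Obj X) (Obj X) (level X s)}"
    then obtain C where C: "C \<in> on_set T (level X s)"
        "A' = on_map T (level X s) (Obj X) (restrict elem_fst (level X s)) C"
        "A = on_map T (level X s) (Obj X) (restrict elem_snd (level X s)) C"
      by (auto simp: rel_lift_def)
    have d: "restrict elem_fst (level X s) \<in> level X s \<rightarrow>\<^sub>E Obj X"
      "restrict elem_snd (level X s) \<in> level X s \<rightarrow>\<^sub>E Obj X"
      by (auto simp: level_def)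
    have fd: "compose (level X s) f (restrict elem_fst (level X s)) \<in> level X s \<rightarrow>\<^sub>E Obj Y"
      "compose (level X s) f (restrict elem_snd (level X s)) \<in> level X s \<rightarrow>\<^sub>E Obj Y"
      using fXY by (auto simp: level_def compose_def)
    have "s \<le> (INF x\<in>level X s. Hom Y (compose (level X s) f (restrict elem_fst (level X s)) x)
        (compose (level X s) f (restrict elem_snd (level X s)) x))"
      using vfunctors_Hom_le[OF f]
      by (intro INF_greatest) (auto simp: compose_def level_def intro: order_trans)
    also note INF_Hom_le_Hom_on_map[OF T Y fd C(1)]
    finally show "s \<le> Hom (on_vcat (vcatification T) Y)
      (on_map T (Obj X) (Obj Y) f A') (on_map T (Obj X) (Obj Y) f A)"
      using on_map_compose_apply[OF T(1) d(1) fXY C(1) refl]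
        on_map_compose_apply[OF T(1) d(2) fXY C(1) refl] C(2,3) by simp
  qed
  then show ?thesis
    using on_map_funcset[OF T(1) fXY] by (simp add: vfunctors_def)
qed

lemma on_vfun_vcatification:
  "f \<in> vfunctors X Y \<Longrightarrow> on_vfun (vcatification T) X Y f = on_map T (Obj X) (Obj Y) f"
  by (simp add: vcatification_def)

lemma vfunctors_id: "(\<lambda>x\<in>Obj X. x) \<in> vfunctors X X"
  by (auto simp: vfunctors_def)

text \<open>The distance in \<open>vfun_cat X Y\<close> is an infimum over objects, so
  \<open>V\<close>-functoriality on homs is \<open>INF_Hom_le_Hom_on_map\<close> with
  \<open>S = Obj X\<close>.\<close>

lemma vcat_functor_vcatification:
  fixes T :: "('a, 'b) set_fun"
  assumes T: "set_functor T" "preserves_weak_pullbacks T"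
  shows "vcat_functor (vcatification T :: ('a elem, 'b, 'v::comm_quantale) vcat_fun)"
  unfolding vcat_functor_def
proof (intro conjI allI impI ballI)
  fix X Y :: "('a elem, 'v) vcat"
  assume X: "vcategory X" and Y: "vcategory Y"
  have "on_vfun (vcatification T) X Y \<in> vfunctors X Y \<rightarrow>\<^sub>E
      vfunctors (on_vcat (vcatification T) X) (on_vcat (vcatification T) Y)"
    using on_map_vfunctor[OF T X Y] by (auto simp: vcatification_def)
  moreover have "(INF x\<in>Obj X. Hom Y (f x) (g x)) \<le>
      (INF A\<in>on_set T (Obj X). Hom (on_vcat (vcatification T) Y)
        (on_vfun (vcatification T) X Y f A) (on_vfun (vcatification T) X Y g A))"
    if "f \<in> vfunctors X Y" "g \<in> vfunctors X Y" for f g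
    unfolding on_vfun_vcatification[OF that(1)] on_vfun_vcatification[OF that(2)]
    by (intro INF_greatest INF_Hom_le_Hom_on_map[OF T Y] that[THEN vfunctors_funcset])
  ultimately show "on_vfun (vcatification T) X Y \<in> vfunctors (vfun_cat X Y)
      (vfun_cat (on_vcat (vcatification T) X) (on_vcat (vcatification T) Y))"
    by (simp add: vfunctors_def[of "vfun_cat X Y"])
next
  fix X Y Z :: "('a elem, 'v) vcat" and f g
  assume f: "f \<in> vfunctors X Y" and g: "g \<in> vfunctors Y Z"
  show "on_vfun (vcatification T) X Z (compose (Obj X) g f) =
      compose (Obj (on_vcat (vcatification T) X)) (on_vfun (vcatification T) Y Z g)
        (on_vfun (vcatification T) X Y f)"
    unfolding on_vfun_vcatification[OF f] on_vfun_vcatification[OF g]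
      on_vfun_vcatification[OF vfunctors_compose[OF f g]] Obj_vcatification
    by (rule on_map_compose[OF T(1) vfunctors_funcset[OF f] vfunctors_funcset[OF g]])
next
  fix X :: "('a elem, 'v) vcat"
  show "on_vfun (vcatification T) X X (\<lambda>x\<in>Obj X. x) =
      (\<lambda>A\<in>Obj (on_vcat (vcatification T :: ('a elem, 'b, 'v) vcat_fun) X). A)"
    by (simp only: on_vfun_vcatification[OF vfunctors_id] on_map_id[OF T(1)] Obj_vcatification)
qed (rule vcategory_vcatification[OF T])

lemma kan_unit_vcatification:
  fixes T :: "('a, 'b) set_fun"
  assumes T: "set_functor T" "preserves_weak_pullbacks T"
  shows "kan_unit T (vcatification T :: ('a elem, 'b, 'v::comm_quantale) vcat_fun)
    (\<lambda>S. \<lambda>A\<in>on_set T S. A)"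
  unfolding kan_unit_def
proof (intro conjI allI ballI)
  fix S
  show "(\<lambda>A\<in>on_set T S. A) \<in> vfunctors (discrete (on_set T S))
      (on_vcat (vcatification T :: ('a elem, 'b, 'v) vcat_fun) (discrete S))"
    by (auto simp: vfunctors_discrete vcategory_vcatification[OF T] vcategory_discrete)
next
  fix S S' and h :: "'a elem \<Rightarrow> 'a elem"
  assume h: "h \<in> S \<rightarrow>\<^sub>E S'"
  then have "on_vfun (vcatification T :: ('a elem, 'b, 'v) vcat_fun) (discrete S) (discrete S') h =
      on_map T S S' h"
    by (simp add: on_vfun_vcatification vfunctors_discrete vcategory_discrete)
  then show "compose (on_set T S)
        (on_vfun (vcatification T :: ('a elem, 'b, 'v) vcat_fun) (discrete S) (discrete S') h)
        (\<lambda>A\<in>on_set T S. A) =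
      compose (on_set T S) (\<lambda>A\<in>on_set T S'. A) (on_map T S S' h)"
    using on_map_in[OF T(1) h] by (auto simp: compose_def)
qed

section \<open>The universal property\<close>

text \<open>The map is the comparison with the universal cocone, after absorbing the identity unit
  and replacing \<open>vfunctors (discrete S) X\<close> by a plain function set.\<close>

lemma vcat_iso_weighted_cocones:
  fixes T :: "('a, 'b) set_fun"
    and X :: "('a elem, 'v::comm_quantale) vcat" and Z :: "('z, 'v) vcat"
  assumes T: "set_functor T" "preserves_weak_pullbacks T"
    and X: "vcategory X" and Z: "vcategory Z"
  shows "vcat_iso (vfun_cat (on_vcat (vcatification T) X) Z) (weighted_cocones T X Z)
    (\<lambda>k S. \<lambda>f\<in>S \<rightarrow>\<^sub>E Obj X. compose (on_set T S) k (on_map T S (Obj X) f))"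
    (is "vcat_iso ?V ?W ?F")
proof -
  let ?TX = "on_set T (Obj X)" and ?id = "\<lambda>x\<in>Obj X. x"
  have id: "?id \<in> Obj X \<rightarrow>\<^sub>E Obj X"
    by auto
  note disc = vfunctors_discrete[OF X] vfunctors_discrete[OF Z]
  have ObjV: "Obj ?V = vfunctors (on_vcat (vcatification T) X) Z"
    by simp
  have k_ext: "k \<in> ?TX \<rightarrow>\<^sub>E Obj Z" if "k \<in> Obj ?V" for k
    using vfunctors_funcset that unfolding ObjV by fastforce
  have F_id: "?F k (Obj X) ?id = k" if "k \<in> Obj ?V" for k
    using k_ext[OF that] id unfolding restrict_apply'[OF id] on_map_id[OF T(1)]
    by (intro extensionalityI[of _ ?TX]) (auto simp: compose_def PiE_def)
  have F_W: "?F k \<in> Obj ?W" if k: "k \<in> Obj ?V" for k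
  proof -
    have kf: "compose (on_set T S) k (on_map T S (Obj X) f) \<in> on_set T S \<rightarrow>\<^sub>E Obj Z"
      if "f \<in> S \<rightarrow>\<^sub>E Obj X" for S f
      using on_map_in[OF T(1) that] k_ext[OF k] by (auto simp: compose_def)
    \<comment> \<open>The enrichment bound for \<open>vcatification T\<close> followed by
      \<open>V\<close>-functoriality of \<open>k\<close> makes each component \<open>?F k S\<close>
      a \<open>V\<close>-functor.\<close>
    have "(INF x\<in>S. Hom X (f x) (g x)) \<le>
        Hom Z (k (on_map T S (Obj X) f A)) (k (on_map T S (Obj X) g A))"
      if f: "f \<in> S \<rightarrow>\<^sub>E Obj X" and g: "g \<in> S \<rightarrow>\<^sub>E Obj X" and A: "A \<in> on_set T S" for S f g A
      using INF_Hom_le_Hom_on_map[OF T X f g A] on_map_in[OF T(1) f A] on_map_in[OF T(1) g A] k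
        vfunctors_Hom_le[of k "on_vcat (vcatification T) X" Z]
      unfolding ObjV Obj_vcatification by (meson order_trans)
    then have "?F k S \<in> vfunctors (vfun_cat (discrete S) X)
        (vfun_cat (discrete (on_set T S)) Z)" for S
      using kf by (auto simp: vfunctors_def[of "vfun_cat (discrete S) X"] disc compose_def
          intro!: INF_greatest)
    moreover have "?F k S' (compose S' f h) = compose (on_set T S') (?F k S f) (on_map T S' S h)"
      if h: "h \<in> S' \<rightarrow>\<^sub>E S" and f: "f \<in> S \<rightarrow>\<^sub>E Obj X" for S S' h f
    proof -
      have "compose S' f h \<in> S' \<rightarrow>\<^sub>E Obj X"
        using f h by (auto simp: compose_def)
      then show ?thesis
        using f on_map_in[OF T(1) h]
        by (simp add: on_map_compose[OF T(1) h f] compose_assoc[of _ "on_set T S'" "on_set T S"])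
    qed
    ultimately show ?thesis
      by (auto simp: weighted_cocones_def disc)
  qed
  have surj: "\<phi> (Obj X) ?id \<in> Obj ?V" "?F (\<phi> (Obj X) ?id) = \<phi>" if \<phi>: "\<phi> \<in> Obj ?W" for \<phi>
  proof -
    define k where "k = \<phi> (Obj X) ?id"
    have \<phi>_fun: "\<phi> S \<in> vfunctors (vfun_cat (discrete S) X) (vfun_cat (discrete (on_set T S)) Z)" for S
      using \<phi> by (simp add: weighted_cocones_def)
    have \<phi>_ext: "\<phi> S \<in> (S \<rightarrow>\<^sub>E Obj X) \<rightarrow>\<^sub>E (on_set T S \<rightarrow>\<^sub>E Obj Z)" for S
      using vfunctors_funcset[OF \<phi>_fun[of S]] by (simp add: disc)
    have \<phi>_eq: "\<phi> S f = compose (on_set T S) k (on_map T S (Obj X) f)"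
      if f: "f \<in> S \<rightarrow>\<^sub>E Obj X" for S f
    proof -
      \<comment> \<open>The Yoneda argument: naturality of \<open>\<phi>\<close> is applied with
        \<open>f\<close> itself as the reindexing map and \<open>?id\<close> as the map into
        \<open>X\<close>.\<close>
      have "\<phi> S (compose S ?id f) = compose (on_set T S) k (on_map T S (Obj X) f)"
        using \<phi> f id unfolding k_def weighted_cocones_def by (simp add: disc)
      moreover have "compose S ?id f = f"
        using f by (intro extensionalityI[of _ S]) (auto simp: compose_def PiE_def)
      ultimately show ?thesis
        by simp
    qed
    have k_ext: "k \<in> ?TX \<rightarrow>\<^sub>E Obj Z"
      using \<phi>_ext[of "Obj X"] id unfolding k_def by blast
    have "Hom (on_vcat (vcatification T) X) A' A \<le> Hom Z (k A') (k A)" for A' A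
      unfolding Hom_vcatification[OF T X]
    proof (rule Sup_least)
      fix s assume "s \<in> {s. (A', A) \<in> rel_lift T (Obj X) (Obj X) (level X s)}"
      then obtain C where C: "C \<in> on_set T (level X s)"
          "A' = on_map T (level X s) (Obj X) (restrict elem_fst (level X s)) C"
          "A = on_map T (level X s) (Obj X) (restrict elem_snd (level X s)) C"
        by (auto simp: rel_lift_def)
      let ?d0 = "restrict elem_fst (level X s)" and ?d1 = "restrict elem_snd (level X s)"
      have d: "?d0 \<in> level X s \<rightarrow>\<^sub>E Obj X" "?d1 \<in> level X s \<rightarrow>\<^sub>E Obj X"
        by (auto simp: level_def)
      \<comment> \<open>A lifted level becomes a pair of maps that \<open>\<phi>\<close> can
        compare: the projections of \<open>level X s\<close> are at distance at least
        \<open>s\<close>.\<close>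
      have "s \<le> (INF x\<in>level X s. Hom X (?d0 x) (?d1 x))"
        by (intro INF_greatest) (auto simp: level_def)
      also have "\<dots> \<le> (INF C\<in>on_set T (level X s).
          Hom Z (\<phi> (level X s) ?d0 C) (\<phi> (level X s) ?d1 C))"
        using vfunctors_Hom_le[OF \<phi>_fun[of "level X s"], of ?d0 ?d1] d
        by (simp add: disc)
      also have "\<dots> \<le> Hom Z (\<phi> (level X s) ?d0 C) (\<phi> (level X s) ?d1 C)"
        using C(1) by (rule INF_lower)
      also have "\<dots> = Hom Z (k A') (k A)"
        using C by (simp add: \<phi>_eq[OF d(1)] \<phi>_eq[OF d(2)] compose_def)
      finally show "s \<le> Hom Z (k A') (k A)" .
    qed
    then show "\<phi> (Obj X) ?id \<in> Obj ?V"
      using k_ext unfolding ObjV k_def[symmetric] by (simp add: vfunctors_def)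
    show "?F (\<phi> (Obj X) ?id) = \<phi>"
      unfolding k_def[symmetric]
    proof (rule ext)
      fix S
      show "?F k S = \<phi> S"
        using \<phi>_ext[of S] \<phi>_eq
        by (intro extensionalityI[of _ "S \<rightarrow>\<^sub>E Obj X"]) (auto simp: PiE_def)
    qed
  qed
  have "bij_betw ?F (Obj ?V) (Obj ?W)"
    by (rule bij_betw_byWitness[where f' = "\<lambda>\<phi>. \<phi> (Obj X) ?id"])
      (use F_id F_W surj in \<open>blast+\<close>)
  \<comment> \<open>The instance \<open>S = Obj X\<close>, \<open>f = ?id\<close> bounds the
    iterated infimum by the one over \<open>?TX\<close>; conversely, every
    \<open>on_map T S (Obj X) f A\<close> lies in \<open>?TX\<close>.\<close>
  moreover have "Hom ?V k l = Hom ?W (?F k) (?F l)" for k l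
  proof -
    have "Hom ?W (?F k) (?F l) = (INF S. INF f\<in>S \<rightarrow>\<^sub>E Obj X. INF A\<in>on_set T S.
        Hom Z (k (on_map T S (Obj X) f A)) (l (on_map T S (Obj X) f A)))"
      by (simp add: weighted_cocones_def disc compose_def)
    also have "\<dots> = (INF A\<in>?TX. Hom Z (k A) (l A))"
    proof (rule antisym)
      have "(INF S. INF f\<in>S \<rightarrow>\<^sub>E Obj X. INF A\<in>on_set T S.
          Hom Z (k (on_map T S (Obj X) f A)) (l (on_map T S (Obj X) f A)))
        \<le> (INF A\<in>?TX. Hom Z (k (on_map T (Obj X) (Obj X) ?id A))
            (l (on_map T (Obj X) (Obj X) ?id A)))"
        by (rule INF_lower2[OF UNIV_I[of "Obj X"]], rule INF_lower[OF id])
      then show "(INF S. INF f\<in>S \<rightarrow>\<^sub>E Obj X. INF A\<in>on_set T S.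
          Hom Z (k (on_map T S (Obj X) f A)) (l (on_map T S (Obj X) f A)))
        \<le> (INF A\<in>?TX. Hom Z (k A) (l A))"
        unfolding on_map_id[OF T(1)] by simp
    next
      show "(INF A\<in>?TX. Hom Z (k A) (l A)) \<le> (INF S. INF f\<in>S \<rightarrow>\<^sub>E Obj X. INF A\<in>on_set T S.
          Hom Z (k (on_map T S (Obj X) f A)) (l (on_map T S (Obj X) f A)))"
        by (intro INF_greatest INF_lower on_map_in[OF T(1)])
    qed
    also have "\<dots> = Hom ?V k l"
      by simp
    finally show ?thesis ..
  qed
  ultimately show ?thesis
    by (simp add: vcat_iso_def)
qed

lemma left_kan_vcatification:
  fixes T :: "('a, 'b) set_fun"
  assumes T: "set_functor T" "preserves_weak_pullbacks T"
  shows "left_kan_along_discrete TYPE('z) T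
    (vcatification T :: ('a elem, 'b, 'v::comm_quantale) vcat_fun) (\<lambda>S. \<lambda>A\<in>on_set T S. A)"
  unfolding left_kan_along_discrete_def
proof (intro conjI allI impI)
  fix X :: "('a elem, 'v) vcat" and Z :: "('z, 'v) vcat"
  assume X: "vcategory X" and Z: "vcategory Z"
  \<comment> \<open>The identity unit drops out on \<open>on_set T S\<close>, and on
    \<open>V\<close>-functors \<open>on_vfun\<close> is \<open>on_map T\<close>; this brings the
    universal cocone into the simplified form.\<close>
  have "(\<lambda>k S. \<lambda>f\<in>vfunctors (discrete S) X. compose (on_set T S) k
        (compose (on_set T S) (on_vfun (vcatification T) (discrete S) X f)
          (\<lambda>A\<in>on_set T S. A))) =
      (\<lambda>(k :: 'b \<Rightarrow> 'z) S. \<lambda>f\<in>S \<rightarrow>\<^sub>E Obj X. compose (on_set T S) k (on_map T S (Obj X) f))"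
    by (intro ext) (auto simp: restrict_def compose_def on_vfun_vcatification
        vfunctors_discrete[OF X])
  then show "vcat_iso (vfun_cat (on_vcat (vcatification T) X) Z) (weighted_cocones T X Z)
      (\<lambda>k S. \<lambda>f\<in>vfunctors (discrete S) X. compose (on_set T S) k
        (compose (on_set T S) (on_vfun (vcatification T) (discrete S) X f)
          (\<lambda>A\<in>on_set T S. A)))"
    using vcat_iso_weighted_cocones[OF T X Z] by simp
qed (simp_all add: vcat_functor_vcatification[OF T] kan_unit_vcatification[OF T])

theorem lemma3p33:
  fixes T :: "('a, 'b) set_fun"
    and T\<^sub>V :: "('a elem, 'b, 'v::comm_quantale) vcat_fun"
  assumes "set_functor T"
    and "preserves_weak_pullbacks T"
    and "T\<^sub>V = vcatification T"
  shows "left_kan_along_discrete TYPE('z) T T\<^sub>V (\<lambda>S. \<lambda>A\<in>on_set T S. A) \<and>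
    (\<forall>X. vcategory X \<longrightarrow>
      Obj (on_vcat T\<^sub>V X) = on_set T (Obj X) \<and>
      (\<forall>A' \<in> on_set T (Obj X). \<forall>A \<in> on_set T (Obj X).
         Hom (on_vcat T\<^sub>V X) A' A =
           Sup {s. (A', A) \<in> rel_lift T (Obj X) (Obj X) (level X s)}))"
  unfolding assms(3)
  by (simp add: left_kan_vcatification[OF assms(1,2)] Hom_vcatification[OF assms(1,2)])

end
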